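(* The critical value based mechanism satisfies feasibility: $x_i(\theta')\le v_i'$ for all $i\in V$ and all $\theta'\in\Theta$.
   Context: **Cost sharing problem.** Let $V$ be a finite set of nodes, $s\notin V$ a source, and $G=\langle V\cup\{s\},E\rangle$ a connected undirected graph in which each edge $(i,j)\in E$ has a cost $c_{(i,j)}\ge 0$. Each $i\in V$ has a private valuation $v_i\ge 0$. For $i\in V\cup\{s\}$ let $e_i$ be the set of edges adjacent to $i$, and let $\theta_i=(e_i,v_i)$ be the type of $i$ (the valuation of $s$ is null). Each node makes a report $\theta_i'=(e_i',v_i')$ with $e_i'\subseteq e_i$ and $v_i'\ge 0$; the source does not behave strategically. Let $\theta'=(\theta_i')_{i\in V\cup\{s\}}$ be the report profile, and $\Theta$ the space of all profiles. The induced graph is $G(\theta')=\langle V\cup\{s\},E(\theta')\rangle$ with $E(\theta')=\{(i,j)\in E : (i,j)\in e_i'\cap e_j'\}$. **Mechanism.** A cost sharing mechanism $(g,f,x)$ consists of $g:\Theta\to 2^V$ (selected nodes), $f:\Theta\to 2^E$ with $f(\theta')\subseteq E(\theta')$ (selected edges connecting the selected nodes), and $x:\Theta\to\mathbb{R}^{|V|}$ (cost shares), with $x_i(\theta')=0$ if $i\notin g(\theta')$. **Social welfare and $\delta$.** For $S\subseteq V$, $C(S)$ is the weight of a minimum Steiner tree of $S\cup\{s\}$ in $G(\theta')$ (a minimum-weight tree containing these nodes, possibly using other nodes); $C(S)=+\infty$ if no such tree exists. $SW(S)=\sum_{i\in S}v_i'-C(S)$. Define $\delta(S)\subseteq S$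 for $S\subseteq V$ in ascending order of cardinality: $\delta(\emptyset)=\emptyset$, $SW(\emptyset)=0$; for $S\ne\emptyset$, if $\sum_{i\in S}v_i'-C(S)\ge\max_{S'} SW(\delta(S'))$, where $S'$ ranges over subsets of $S$ with $|S'|=|S|-1$, then $\delta(S)=S$; otherwise $\delta(S)=\delta(S^* )$ for an $S^*$ attaining this maximum. (So $\delta(S)$ is a subset of $S$ of maximal social welfare.) **Critical value based mechanism (CVM).** Given $\theta'$: set $g(\theta')=\delta(V)$; let $f(\theta')$ be the edge set of a minimum Steiner tree of $g(\theta')\cup\{s\}$ in $G(\theta')$; for $i\in g(\theta')$ set $$x_i(\theta')=CV_i(\theta')=\Big(\sum_{j\in\delta(g(\theta')\setminus\{i\})}v_j'-C(\delta(g(\theta')\setminus\{i\}))\Big)-\Big(\sum_{k\in g(\theta')\setminus\{i\}}v_k'-C(g(\theta'))\Big),$$ and $x_i(\theta')=0$ for $i\notin g(\theta')$. *)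

theory Defs
  imports Complex_Main "HOL-Library.Extended_Real" "HOL-Library.FuncSet"
begin

text \<open>A simple undirected graph is given by a vertex set \<open>N\<close> and a set \<open>T\<close> of two-element
  subsets of \<open>N\<close>; the edge \<open>(i,j)\<close> is the set \<open>{i,j}\<close>.\<close>

definition simple_graph :: "'a set \<Rightarrow> 'a set set \<Rightarrow> bool" where
  "simple_graph N T \<longleftrightarrow> (\<forall>e\<in>T. e \<subseteq> N \<and> card e = 2)"

definition adj :: "'a set set \<Rightarrow> ('a \<times> 'a) set" where
  "adj T = {(x, y). {x, y} \<in> T}"

definition connected_graph :: "'a set \<Rightarrow> 'a set set \<Rightarrow> bool" where
  "connected_graph N T \<longleftrightarrow>
     simple_graph N T \<and> N \<noteq> {} \<and> (\<forall>x\<in>N. \<forall>y\<in>N. (x, y) \<in> (adj T)\<^sup>*)"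

definition graph_cycle :: "'a set set \<Rightarrow> 'a list \<Rightarrow> bool" where
  "graph_cycle T p \<longleftrightarrow> length p \<ge> 3 \<and> distinct p \<and>
     (\<forall>k < length p. {p ! k, p ! (Suc k mod length p)} \<in> T)"

definition is_tree :: "'a set \<Rightarrow> 'a set set \<Rightarrow> bool" where
  "is_tree N T \<longleftrightarrow> connected_graph N T \<and> (\<nexists>p. graph_cycle T p)"

text \<open>A report is a pair of a set of adjacent edges and a valuation.\<close>

type_synonym 'a report = "'a set set \<times> real"
type_synonym 'a profile = "'a \<Rightarrow> 'a report"

locale cost_sharing_problem =
  fixes V :: "'a set" and s :: 'a and E :: "'a set set"
    and c :: "'a set \<Rightarrow> real" and v :: "'a \<Rightarrow> real"
  assumes finite_V: "finite V"
    and source: "s \<notin> V"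
    and graph: "connected_graph (insert s V) E"
    and cost_nonneg: "\<And>e. e \<in> E \<Longrightarrow> c e \<ge> 0"
    and valuation_nonneg: "\<And>i. i \<in> V \<Longrightarrow> v i \<ge> 0"
    and source_valuation: "v s = 0"
begin

definition incident :: "'a \<Rightarrow> 'a set set" where
  "incident i = {e \<in> E. i \<in> e}"

definition true_type :: "'a \<Rightarrow> 'a report" where
  "true_type i = (incident i, v i)"

text \<open>The source is not strategic: its only report is its true type.\<close>

definition reports :: "'a \<Rightarrow> 'a report set" where
  "reports i = (if i = s then {true_type s} else Pow (incident i) \<times> {0..})"

definition profiles :: "'a profile set" where
  "profiles = (\<Pi>\<^sub>E i\<in>insert s V. reports i)"

definition induced_edges :: "'a profile \<Rightarrow> 'a set set" where
  "induced_edges \<theta> = {{i, j} | i j. {i, j} \<in> E \<and> {i, j} \<in> fst (\<theta> i) \<inter> fst (\<theta> j)}"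

definition cost_sharing_mechanism ::
  "('a profile \<Rightarrow> 'a set) \<Rightarrow> ('a profile \<Rightarrow> 'a set set) \<Rightarrow> ('a profile \<Rightarrow> 'a \<Rightarrow> real) \<Rightarrow> bool" where
  "cost_sharing_mechanism g f x \<longleftrightarrow> (\<forall>\<theta>\<in>profiles.
     g \<theta> \<subseteq> V \<and> f \<theta> \<subseteq> induced_edges \<theta> \<and>
     (\<forall>i\<in>g \<theta>. (s, i) \<in> (adj (f \<theta>))\<^sup>*) \<and>
     (\<forall>i\<in>V - g \<theta>. x \<theta> i = 0))"

text \<open>Edge sets of the trees of the induced graph that contain the nodes \<open>S \<union> {s}\<close>
  (\<open>N\<close> is the vertex set of the tree).\<close>

definition steiner_trees :: "'a profile \<Rightarrow> 'a set \<Rightarrow> 'a set set set" where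
  "steiner_trees \<theta> S = {T. T \<subseteq> induced_edges \<theta> \<and>
     (\<exists>N. insert s S \<subseteq> N \<and> N \<subseteq> insert s V \<and> is_tree N T)}"

definition min_steiner_tree :: "'a profile \<Rightarrow> 'a set \<Rightarrow> 'a set set \<Rightarrow> bool" where
  "min_steiner_tree \<theta> S T \<longleftrightarrow>
     T \<in> steiner_trees \<theta> S \<and> (\<forall>T'\<in>steiner_trees \<theta> S. sum c T \<le> sum c T')"

text \<open>There are only finitely many Steiner trees, so the infimum is a minimum; over the empty
  family it is \<open>\<infinity>\<close>.\<close>

definition C :: "'a profile \<Rightarrow> 'a set \<Rightarrow> ereal" where
  "C \<theta> S = (INF T\<in>steiner_trees \<theta> S. ereal (sum c T))"

definition SW :: "'a profile \<Rightarrow> 'a set \<Rightarrow> ereal" where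
  "SW \<theta> S = ereal (\<Sum>i\<in>S. snd (\<theta> i)) - C \<theta> S"

definition maximal_subsets :: "'a set \<Rightarrow> 'a set set" where
  "maximal_subsets S = {S'. S' \<subseteq> S \<and> card S' = card S - 1}"

text \<open>The recursion leaves open which maximiser \<open>S*\<close> is taken, so \<open>is_delta \<theta> \<delta>\<close>
  says that \<open>\<delta>\<close> is a function obeying the recursion for some way of breaking ties.\<close>

definition is_delta :: "'a profile \<Rightarrow> ('a set \<Rightarrow> 'a set) \<Rightarrow> bool" where
  "is_delta \<theta> \<delta> \<longleftrightarrow> \<delta> {} = {} \<and>
     (\<forall>S. S \<subseteq> V \<and> S \<noteq> {} \<longrightarrow>
       (let m = Max ((\<lambda>S'. SW \<theta> (\<delta> S')) ` maximal_subsets S) in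
         if SW \<theta> S \<ge> m then \<delta> S = S
         else (\<exists>S'\<in>maximal_subsets S. SW \<theta> (\<delta> S') = m \<and> \<delta> S = \<delta> S')))"

definition CV :: "'a profile \<Rightarrow> ('a set \<Rightarrow> 'a set) \<Rightarrow> 'a set \<Rightarrow> 'a \<Rightarrow> ereal" where
  "CV \<theta> \<delta> S i =
     (ereal (\<Sum>j\<in>\<delta> (S - {i}). snd (\<theta> j)) - C \<theta> (\<delta> (S - {i})))
     - (ereal (\<Sum>k\<in>S - {i}. snd (\<theta> k)) - C \<theta> S)"

text \<open>A critical value based mechanism, for arbitrary tie-breaking both in \<open>\<delta>\<close> and in the
  choice of the minimum Steiner tree. The critical values of selected nodes are always finite
  (see \<open>CV_finite\<close> below), so the equation determines the real number \<open>x \<theta> i\<close>.\<close>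

definition critical_value_mechanism ::
  "('a profile \<Rightarrow> 'a set) \<Rightarrow> ('a profile \<Rightarrow> 'a set set) \<Rightarrow> ('a profile \<Rightarrow> 'a \<Rightarrow> real) \<Rightarrow> bool" where
  "critical_value_mechanism g f x \<longleftrightarrow> (\<forall>\<theta>\<in>profiles. \<exists>\<delta>. is_delta \<theta> \<delta> \<and>
     g \<theta> = \<delta> V \<and>
     min_steiner_tree \<theta> (g \<theta>) (f \<theta>) \<and>
     (\<forall>i\<in>g \<theta>. ereal (x \<theta> i) = CV \<theta> \<delta> (g \<theta>) i) \<and>
     (\<forall>i\<in>V - g \<theta>. x \<theta> i = 0))"

lemma finite_edges: "finite E"
proof (rule finite_subset)
  show "E \<subseteq> Pow (insert s V)"
    using graph by (auto simp: connected_graph_def simple_graph_def)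
qed (simp add: finite_V)

lemma induced_edges_subset: "induced_edges \<theta> \<subseteq> E"
  by (auto simp: induced_edges_def)

lemma finite_steiner_trees: "finite (steiner_trees \<theta> S)"
  by (rule finite_subset[of _ "Pow E"])
     (use induced_edges_subset finite_edges in \<open>auto simp: steiner_trees_def\<close>)

lemma min_steiner_tree_exists:
  assumes "steiner_trees \<theta> S \<noteq> {}"
  shows "\<exists>T. min_steiner_tree \<theta> S T"
proof -
  obtain T where "is_arg_min (sum c) (\<lambda>T. T \<in> steiner_trees \<theta> S) T"
    using ex_is_arg_min_if_finite[OF finite_steiner_trees assms] by blast
  then show ?thesis
    by (intro exI[of _ T]) (auto simp: min_steiner_tree_def is_arg_min_linorder)
qed

lemma C_eq:
  assumes "min_steiner_tree \<theta> S T"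
  shows "C \<theta> S = ereal (sum c T)"
  unfolding C_def
  by (rule antisym)
     (use assms in \<open>auto simp: min_steiner_tree_def intro!: INF_lower INF_greatest\<close>)

lemma C_nonneg: "C \<theta> S \<ge> 0"
  unfolding C_def
proof (rule INF_greatest)
  fix T assume "T \<in> steiner_trees \<theta> S"
  then have "T \<subseteq> E" using induced_edges_subset by (auto simp: steiner_trees_def)
  then show "0 \<le> ereal (sum c T)" using cost_nonneg by (auto intro!: sum_nonneg)
qed

lemma C_empty: "C \<theta> {} = 0"
proof (rule antisym)
  have "{} \<in> steiner_trees \<theta> {}"
    by (auto simp: steiner_trees_def is_tree_def connected_graph_def simple_graph_def
        graph_cycle_def intro!: exI[of _ "{s}"] exI[of _ 0])
  then show "C \<theta> {} \<le> 0"
    unfolding C_def by (rule INF_lower2) simp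
qed (rule C_nonneg)

lemma SW_empty: "SW \<theta> {} = 0"
  by (simp add: SW_def C_empty)

lemma maximal_subsets_finite: "S \<subseteq> V \<Longrightarrow> finite (maximal_subsets S)"
  using finite_subset[OF _ finite_V] by (auto simp: maximal_subsets_def)

lemma Diff_in_maximal_subsets: "S \<subseteq> V \<Longrightarrow> i \<in> S \<Longrightarrow> S - {i} \<in> maximal_subsets S"
  using finite_subset[OF _ finite_V, of S] by (auto simp: maximal_subsets_def)

lemma is_delta_exists: "\<exists>\<delta>. is_delta \<theta> \<delta>"
proof -
  define m where "m \<delta> S = Max ((\<lambda>S'. SW \<theta> (\<delta> S')) ` maximal_subsets S)" for \<delta> S
  define step where "step d S = (if SW \<theta> S \<ge> m d S then S
      else d (SOME S'. S' \<in> maximal_subsets S \<and> SW \<theta> (d S') = m d S))" for d S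
  define D where "D = rec_nat (\<lambda>S. {}) (\<lambda>n. step)"
  define \<delta> where "\<delta> S = D (card S) S" for S :: "'a set"
  have D0: "D 0 = (\<lambda>S. {})" and DS: "D (Suc n) = step (D n)" for n
    by (simp_all add: D_def)
  have "if SW \<theta> S \<ge> m \<delta> S then \<delta> S = S
         else (\<exists>S'\<in>maximal_subsets S. SW \<theta> (\<delta> S') = m \<delta> S \<and> \<delta> S = \<delta> S')"
    if S: "S \<subseteq> V" "S \<noteq> {}" for S
  proof -
    have fin: "finite S" using S finite_V finite_subset by blast
    then obtain n where n: "card S = Suc n"
      using S by (metis card_eq_0_iff not0_implies_Suc)
    have eq: "D n S' = \<delta> S'" if "S' \<in> maximal_subsets S" for S'
      using that n by (simp add: \<delta>_def maximal_subsets_def)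
    then have meq: "m (D n) S = m \<delta> S"
      unfolding m_def by (metis (no_types, lifting) image_cong)
    obtain i where "i \<in> S" using S by blast
    then have ne: "maximal_subsets S \<noteq> {}"
      using Diff_in_maximal_subsets[OF S(1)] by blast
    have "m (D n) S \<in> (\<lambda>S'. SW \<theta> (D n S')) ` maximal_subsets S"
      unfolding m_def by (rule Max_in) (use ne maximal_subsets_finite[OF S(1)] in auto)
    then have "\<exists>S'. S' \<in> maximal_subsets S \<and> SW \<theta> (D n S') = m (D n) S" by fastforce
    from someI_ex[OF this] obtain S' where
      "S' = (SOME S'. S' \<in> maximal_subsets S \<and> SW \<theta> (D n S') = m (D n) S)"
      "S' \<in> maximal_subsets S" "SW \<theta> (D n S') = m (D n) S" by blast
    then have S': "S' \<in> maximal_subsets S" "SW \<theta> (\<delta> S') = m \<delta> S"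
      "\<delta> S = (if SW \<theta> S \<ge> m \<delta> S then S else \<delta> S')"
      using eq[of S'] meq n DS[of n] by (simp_all add: \<delta>_def step_def)
    then show ?thesis by auto
  qed
  moreover have "\<delta> {} = {}" by (simp add: \<delta>_def D0)
  ultimately show ?thesis
    unfolding is_delta_def m_def Let_def by blast
qed

lemma is_delta_subset_nonneg:
  assumes "is_delta \<theta> \<delta>" "S \<subseteq> V"
  shows "\<delta> S \<subseteq> S \<and> SW \<theta> (\<delta> S) \<ge> 0"
  using assms(2)
proof (induction "card S" arbitrary: S rule: less_induct)
  case less
  show ?case
  proof (cases "S = {}")
    case True
    then show ?thesis using assms(1) by (simp add: is_delta_def SW_empty)
  next
    case False
    let ?m = "Max ((\<lambda>S'. SW \<theta> (\<delta> S')) ` maximal_subsets S)"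
    have fin: "finite S" using less.prems finite_V finite_subset by blast
    have IH: "\<delta> S' \<subseteq> S \<and> SW \<theta> (\<delta> S') \<ge> 0" if "S' \<in> maximal_subsets S" for S'
    proof -
      have "card S' < card S" "S' \<subseteq> S"
        using that False fin by (auto simp: maximal_subsets_def card_gt_0_iff)
      then show ?thesis using less.hyps[of S'] less.prems by blast
    qed
    obtain i where "i \<in> S" using False by blast
    then have *: "S - {i} \<in> maximal_subsets S"
      using Diff_in_maximal_subsets less.prems by blast
    then have "SW \<theta> (\<delta> (S - {i})) \<le> ?m"
      using maximal_subsets_finite[OF less.prems] by (intro Max_ge) auto
    then have m: "?m \<ge> 0" using IH[OF *] order_trans by blast
    have step: "if SW \<theta> S \<ge> ?m then \<delta> S = S
         else (\<exists>S'\<in>maximal_subsets S. SW \<theta> (\<delta> S') = ?m \<and> \<delta> S = \<delta> S')"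
      using assms(1) less.prems False unfolding is_delta_def Let_def by blast
    show ?thesis
    proof (cases "SW \<theta> S \<ge> ?m")
      case True
      then show ?thesis using step m order_trans by auto
    next
      case False
      then show ?thesis using step IH by metis
    qed
  qed
qed

lemma C_finite:
  assumes "SW \<theta> S \<ge> 0"
  shows "\<bar>C \<theta> S\<bar> \<noteq> \<infinity>"
  using assms C_nonneg[of \<theta> S] by (cases "C \<theta> S") (auto simp: SW_def)

lemma CV_finite:
  assumes "is_delta \<theta> \<delta>"
  shows "\<bar>CV \<theta> \<delta> (\<delta> V) i\<bar> \<noteq> \<infinity>"
proof -
  have V: "\<delta> V \<subseteq> V" "SW \<theta> (\<delta> V) \<ge> 0"
    using is_delta_subset_nonneg[OF assms, of V] by auto
  then have "\<delta> V - {i} \<subseteq> V" by blast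
  then have "SW \<theta> (\<delta> (\<delta> V - {i})) \<ge> 0"
    using is_delta_subset_nonneg[OF assms] by blast
  then have "\<bar>C \<theta> (\<delta> (\<delta> V - {i}))\<bar> \<noteq> \<infinity>" by (rule C_finite)
  moreover have "\<bar>C \<theta> (\<delta> V)\<bar> \<noteq> \<infinity>" by (rule C_finite) (rule V)
  ultimately show ?thesis by (auto simp: CV_def)
qed

lemma critical_value_mechanism_exists: "\<exists>g f x. critical_value_mechanism g f x"
proof -
  define \<delta> where "\<delta> \<theta> = (SOME d. is_delta \<theta> d)" for \<theta>
  have \<delta>: "is_delta \<theta> (\<delta> \<theta>)" for \<theta>
    unfolding \<delta>_def using is_delta_exists by (rule someI_ex)
  define f where "f \<theta> = (SOME T. min_steiner_tree \<theta> (\<delta> \<theta> V) T)" for \<theta>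
  have f: "min_steiner_tree \<theta> (\<delta> \<theta> V) (f \<theta>)" for \<theta>
    unfolding f_def
  proof (rule someI_ex, rule min_steiner_tree_exists)
    have "SW \<theta> (\<delta> \<theta> V) \<ge> 0" using is_delta_subset_nonneg[OF \<delta>, of V] by simp
    from C_finite[OF this] show "steiner_trees \<theta> (\<delta> \<theta> V) \<noteq> {}"
      by (auto simp: C_def top_ereal_def)
  qed
  define x where
    "x \<theta> i = (if i \<in> \<delta> \<theta> V then real_of_ereal (CV \<theta> (\<delta> \<theta>) (\<delta> \<theta> V) i) else 0)" for \<theta> i
  have "ereal (x \<theta> i) = CV \<theta> (\<delta> \<theta>) (\<delta> \<theta> V) i" if "i \<in> \<delta> \<theta> V" for \<theta> i
    using that CV_finite[OF \<delta>, of \<theta> i] by (simp add: x_def ereal_real)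
  moreover have "x \<theta> i = 0" if "i \<notin> \<delta> \<theta> V" for \<theta> i using that by (simp add: x_def)
  ultimately have "critical_value_mechanism (\<lambda>\<theta>. \<delta> \<theta> V) f x"
    unfolding critical_value_mechanism_def
  proof (intro ballI, goal_cases)
    case (1 \<theta>)
    then show ?case by (intro exI[of _ "\<delta> \<theta>"] conjI \<delta> refl f ballI) simp_all
  qed
  then show ?thesis by (intro exI)
qed

lemma critical_value_mechanism_is_mechanism:
  assumes "critical_value_mechanism g f x"
  shows "cost_sharing_mechanism g f x"
  unfolding cost_sharing_mechanism_def
proof
  fix \<theta> assume "\<theta> \<in> profiles"
  then obtain \<delta> where d: "is_delta \<theta> \<delta>" "g \<theta> = \<delta> V" "min_steiner_tree \<theta> (g \<theta>) (f \<theta>)"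
    "\<forall>i\<in>V - g \<theta>. x \<theta> i = 0"
    using assms unfolding critical_value_mechanism_def by blast
  then have "f \<theta> \<in> steiner_trees \<theta> (g \<theta>)" by (simp add: min_steiner_tree_def)
  then have "f \<theta> \<subseteq> induced_edges \<theta>" "\<forall>i\<in>g \<theta>. (s, i) \<in> (adj (f \<theta>))\<^sup>*"
    by (auto simp: steiner_trees_def is_tree_def connected_graph_def)
  then show "g \<theta> \<subseteq> V \<and> f \<theta> \<subseteq> induced_edges \<theta> \<and>
     (\<forall>i\<in>g \<theta>. (s, i) \<in> (adj (f \<theta>))\<^sup>*) \<and> (\<forall>i\<in>V - g \<theta>. x \<theta> i = 0)"
    using d is_delta_subset_nonneg[OF d(1), of V] by auto
qed

end

end

theory Submission
  imports Defs
begin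

text \<open>Every value of \<open>\<delta>\<close> is a fixed point of \<open>\<delta>\<close>, so the selected set \<open>D = \<delta> V\<close> passes the
  test of the recursion, \<open>SW D \<ge> SW (\<delta> (D - {i}))\<close>. Since
  \<open>CV\<^sub>i = SW (\<delta> (D - {i})) - (SW D - v\<^sub>i)\<close>, this gives \<open>CV\<^sub>i \<le> v\<^sub>i\<close>.\<close>

context cost_sharing_problem
begin

lemma is_delta_step:
  assumes "is_delta \<theta> \<delta>" "S \<subseteq> V" "S \<noteq> {}"
  shows "if SW \<theta> S \<ge> Max ((\<lambda>S'. SW \<theta> (\<delta> S')) ` maximal_subsets S) then \<delta> S = S
    else (\<exists>S'\<in>maximal_subsets S.
      SW \<theta> (\<delta> S') = Max ((\<lambda>S'. SW \<theta> (\<delta> S')) ` maximal_subsets S) \<and> \<delta> S = \<delta> S')"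
  using assms unfolding is_delta_def Let_def by blast

lemma maximal_subset_psubset:
  assumes "S \<subseteq> V" "S \<noteq> {}" "S' \<in> maximal_subsets S"
  shows "S' \<subset> S"
proof -
  have "finite S" using assms(1) finite_V finite_subset by blast
  \<comment> \<open>For \<open>S = {}\<close> truncated subtraction would give
    \<open>card S - 1 = 0\<close> and make \<open>S\<close> a maximal subset of itself.\<close>
  then have "card S > 0" using assms(2) by (simp add: card_gt_0_iff)
  then show ?thesis using assms(3) by (auto simp: maximal_subsets_def)
qed

text \<open>Either branch of the recursion preserves the property: \<open>\<delta> S\<close> is
  \<open>S\<close> itself, or it is inherited from a strictly smaller set, to which the induction
  hypothesis applies.\<close>

lemma is_delta_idem:
  assumes "is_delta \<theta> \<delta>" "S \<subseteq> V"
  shows "\<delta> (\<delta> S) = \<delta> S"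
proof -
  have "finite S" using assms(2) finite_V finite_subset by blast
  then show ?thesis using assms(2)
  proof (induction S rule: finite_psubset_induct)
    case (psubset S)
    show ?case
    proof (cases "S = {}")
      case True
      then show ?thesis using assms(1) by (simp add: is_delta_def)
    next
      case False
      then have "\<delta> S = S \<or> (\<exists>S'\<in>maximal_subsets S. \<delta> S = \<delta> S')"
        using is_delta_step[OF assms(1) psubset.prems] by meson
      then show ?thesis
      proof
        assume "\<exists>S'\<in>maximal_subsets S. \<delta> S = \<delta> S'"
        then obtain S' where S': "S' \<in> maximal_subsets S" "\<delta> S = \<delta> S'" by blast
        have "S' \<subset> S" using maximal_subset_psubset psubset.prems False S'(1) by blast
        then show ?thesis using psubset.IH[of S'] psubset.prems S'(2) by auto
      qed simp
    qed
  qed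
qed

text \<open>A fixed point can only come from the first branch of the recursion, so \<open>S\<close>
  beats the maximum over its maximal subsets, and \<open>S - {i}\<close> is one of them.\<close>

lemma SW_fixed_point_ge:
  assumes "is_delta \<theta> \<delta>" "S \<subseteq> V" "\<delta> S = S" "i \<in> S"
  shows "SW \<theta> (\<delta> (S - {i})) \<le> SW \<theta> S"
proof -
  let ?m = "Max ((\<lambda>S'. SW \<theta> (\<delta> S')) ` maximal_subsets S)"
  have ne: "S \<noteq> {}" using assms(4) by blast
  \<comment> \<open>This excludes the second branch: it would place \<open>\<delta> S = S\<close>
    inside a proper subset of \<open>S\<close>.\<close>
  have "\<delta> S \<noteq> \<delta> S'" if "S' \<in> maximal_subsets S" for S'
    using maximal_subset_psubset[OF assms(2) ne that] is_delta_subset_nonneg[OF assms(1), of S']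
      assms(2,3) by blast
  then have "?m \<le> SW \<theta> S"
    using is_delta_step[OF assms(1,2) ne] by meson
  moreover have "SW \<theta> (\<delta> (S - {i})) \<le> ?m"
    using maximal_subsets_finite[OF assms(2)] Diff_in_maximal_subsets[OF assms(2,4)]
    by (intro Max_ge) auto
  ultimately show ?thesis by order
qed

lemma CV_le_valuation:
  assumes "is_delta \<theta> \<delta>" "i \<in> \<delta> V"
  shows "CV \<theta> \<delta> (\<delta> V) i \<le> ereal (snd (\<theta> i))"
proof -
  let ?D = "\<delta> V"
  have D: "?D \<subseteq> V" "SW \<theta> ?D \<ge> 0"
    using is_delta_subset_nonneg[OF assms(1), of V] by auto
  \<comment> \<open>\<open>CV\<close> leaves out the valuation of \<open>i\<close> while
    \<open>SW \<theta> ?D\<close> counts it; this difference is the bound to be proved.\<close>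
  have sum: "(\<Sum>k\<in>?D. snd (\<theta> k)) = snd (\<theta> i) + (\<Sum>k\<in>?D - {i}. snd (\<theta> k))"
    using D(1) assms(2) finite_V finite_subset sum.remove by metis
  have "SW \<theta> (\<delta> (?D - {i})) \<le> SW \<theta> ?D"
    using SW_fixed_point_ge[OF assms(1) D(1) _ assms(2)] is_delta_idem[OF assms(1)] by simp
  \<comment> \<open>In \<open>ereal\<close>, moving the cost of \<open>?D\<close> across the
    inequality is sound because that cost is finite.\<close>
  moreover have "\<bar>C \<theta> ?D\<bar> \<noteq> \<infinity>" using D(2) by (rule C_finite)
  ultimately show ?thesis
    using sum by (cases "C \<theta> ?D"; cases "C \<theta> (\<delta> (?D - {i}))") (auto simp: CV_def SW_def)
qed

text \<open>This settles the unselected nodes: their share is 0, so feasibility for them is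
  nonnegativity of the report.\<close>

lemma profile_valuation_nonneg:
  assumes "\<theta> \<in> profiles" "i \<in> V"
  shows "snd (\<theta> i) \<ge> 0"
proof -
  have "\<theta> i \<in> reports i" using assms by (auto simp: profiles_def)
  moreover have "i \<noteq> s" using assms(2) source by blast
  ultimately show ?thesis by (auto simp: reports_def)
qed

lemma critical_value_mechanism_feasible:
  assumes "critical_value_mechanism g f x" "\<theta> \<in> profiles" "i \<in> V"
  shows "x \<theta> i \<le> snd (\<theta> i)"
proof -
  obtain \<delta> where \<delta>: "is_delta \<theta> \<delta>" "g \<theta> = \<delta> V"
    "\<forall>i\<in>g \<theta>. ereal (x \<theta> i) = CV \<theta> \<delta> (g \<theta>) i" "\<forall>i\<in>V - g \<theta>. x \<theta> i = 0"
    using assms(1,2) unfolding critical_value_mechanism_def by blast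
  show ?thesis
  proof (cases "i \<in> g \<theta>")
    case True
    then have "ereal (x \<theta> i) \<le> ereal (snd (\<theta> i))"
      using \<delta> CV_le_valuation by simp
    then show ?thesis by simp
  next
    case False
    then show ?thesis using \<delta>(4) assms(2,3) profile_valuation_nonneg by simp
  qed
qed

end

theorem theorem5p3:
  fixes V :: "'a set" and s :: 'a and E :: "'a set set"
    and c :: "'a set \<Rightarrow> real" and v :: "'a \<Rightarrow> real"
    and g :: "'a profile \<Rightarrow> 'a set" and f :: "'a profile \<Rightarrow> 'a set set"
    and x :: "'a profile \<Rightarrow> 'a \<Rightarrow> real"
  assumes "cost_sharing_problem V s E c v"
    and "cost_sharing_problem.critical_value_mechanism V s E c v g f x"
  shows "\<forall>\<theta>\<in>cost_sharing_problem.profiles V s E v. \<forall>i\<in>V. x \<theta> i \<le> snd (\<theta> i)"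
  using cost_sharing_problem.critical_value_mechanism_feasible[OF assms] by blast

end
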